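(* Let $G_1$ and $G_2$ be looped simple graphs. The following are equivalent: (1) up to isomorphism, $G_2$ can be obtained from $G_1$ by complementing the loop status of some vertices; (2) there is a compatible isomorphism $\beta:M(IAS(G_1))\to M(IAS(G_2))$ such that $f_\beta(v)\in\{1,(\chi\psi)\}$ for all $v\in V(G_1)$.
   Context: A looped simple graph is a finite graph in which each vertex may carry at most one loop and distinct non-loop edges join distinct pairs of vertices. $A(G)$ is the adjacency matrix over $GF(2)$ (diagonal $1$ iff looped). $M(IAS(G))$ is the binary matroid represented by the columns of $(I\mid A(G)\mid I+A(G))$; its ground set consists of columns $v_\phi,v_\chi,v_\psi$, the columns of $v$ in $I$, $A(G)$, $I+A(G)$. $S_3$ is the permutation group of $\{\phi,\chi,\psi\}$. A compatible isomorphism $\beta$ is a matroid isomorphism mapping each cell $\{v_\phi,v_\chi,v_\psi\}$ onto some cell $\{w_\phi,w_\chi,w_\psi\}$; it induces a bijection $\beta:V(G_1)\to V(G_2)$ and $f_\beta:V(G_1)\to S_3$ with $\beta(v_\iota)=\beta(v)_{f_\beta(v)(\iota)}$. *)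

theory Defs
  imports
    Complex_Main
    "HOL-Library.Z2"
    "HOL-Library.Function_Algebras"
    "HOL-Combinatorics.Transposition"
    "HOL-Combinatorics.Permutations"
begin

section \<open>Looped simple graphs\<close>

text \<open>
  An edge is the set of its endpoints, so a loop at \<open>v\<close> is the edge \<open>{v}\<close>. Parallel edges and
  multiple loops cannot arise because the edges form a set.
\<close>

record 'v graph =
  verts :: "'v set"
  edges :: "'v set set"

definition looped_simple_graph :: "'v graph \<Rightarrow> bool" where
  "looped_simple_graph G \<longleftrightarrow>
     finite (verts G) \<and> edges G \<subseteq> {{u, v} | u v. u \<in> verts G \<and> v \<in> verts G}"

definition graph_isomorphism :: "'v graph \<Rightarrow> 'w graph \<Rightarrow> ('v \<Rightarrow> 'w) \<Rightarrow> bool" where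
  "graph_isomorphism G H h \<longleftrightarrow>
     bij_betw h (verts G) (verts H) \<and>
     (\<forall>u\<in>verts G. \<forall>v\<in>verts G. {u, v} \<in> edges G \<longleftrightarrow> {h u, h v} \<in> edges H)"

definition isomorphic_graphs :: "'v graph \<Rightarrow> 'w graph \<Rightarrow> bool" where
  "isomorphic_graphs G H \<longleftrightarrow> (\<exists>h. graph_isomorphism G H h)"

definition complement_loops :: "'v graph \<Rightarrow> 'v set \<Rightarrow> 'v graph" where
  "complement_loops G S =
     (let L = (\<lambda>v. {v}) ` S in G\<lparr>edges := (edges G - L) \<union> (L - edges G)\<rparr>)"

lemma looped_simple_graph_complement_loops:
  assumes "looped_simple_graph G" "S \<subseteq> verts G"
  shows "looped_simple_graph (complement_loops G S)"
  using assms unfolding looped_simple_graph_def complement_loops_def Let_def by auto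

section \<open>Matroids\<close>

record 'e matroid =
  ground :: "'e set"
  indeps :: "'e set set"

definition is_matroid :: "'e matroid \<Rightarrow> bool" where
  "is_matroid M \<longleftrightarrow>
     finite (ground M) \<and> indeps M \<subseteq> Pow (ground M) \<and> {} \<in> indeps M \<and>
     (\<forall>I\<in>indeps M. \<forall>J. J \<subseteq> I \<longrightarrow> J \<in> indeps M) \<and>
     (\<forall>I\<in>indeps M. \<forall>J\<in>indeps M. card I < card J \<longrightarrow> (\<exists>e\<in>J - I. insert e I \<in> indeps M))"

definition matroid_isomorphism :: "'e matroid \<Rightarrow> 'f matroid \<Rightarrow> ('e \<Rightarrow> 'f) \<Rightarrow> bool" where
  "matroid_isomorphism M N \<beta> \<longleftrightarrow>
     bij_betw \<beta> (ground M) (ground N) \<and>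
     (\<forall>S. S \<subseteq> ground M \<longrightarrow> (S \<in> indeps M \<longleftrightarrow> \<beta> ` S \<in> indeps N))"

text \<open>Vectors over \<open>GF(2)\<close> with coordinates indexed by \<open>'r\<close> are functions into \<^typ>\<open>bit\<close>.\<close>

definition gf2_scale :: "bit \<Rightarrow> ('r \<Rightarrow> bit) \<Rightarrow> 'r \<Rightarrow> bit" where
  "gf2_scale c x = (\<lambda>r. c * x r)"

global_interpretation gf2: vector_space gf2_scale
  by unfold_locales (auto simp: gf2_scale_def fun_eq_iff algebra_simps)

text \<open>
  The binary matroid on the column labels \<open>C\<close> of a matrix \<open>A\<close> (rows first). A set of labels is
  independent iff the corresponding family of columns is; the injectivity condition makes
  distinct labels with equal columns dependent.
\<close>

definition binary_matroid :: "('r \<Rightarrow> 'c \<Rightarrow> bit) \<Rightarrow> 'c set \<Rightarrow> 'c matroid" where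
  "binary_matroid A C =
     (let col = (\<lambda>c r. A r c) in
      \<lparr>ground = C, indeps = {S. S \<subseteq> C \<and> inj_on col S \<and> gf2.independent (col ` S)}\<rparr>)"

lemma is_matroid_binary_matroid:
  assumes "finite C"
  shows "is_matroid (binary_matroid A C)"
proof -
  define col where "col = (\<lambda>c r. A r c)"
  have eq: "binary_matroid A C =
      \<lparr>ground = C, indeps = {S. S \<subseteq> C \<and> inj_on col S \<and> gf2.independent (col ` S)}\<rparr>"
    by (simp add: binary_matroid_def col_def Let_def)
  have augment: "\<exists>e\<in>J - I. e \<in> C \<and> inj_on col (insert e I) \<and> gf2.independent (col ` insert e I)"
    if I: "I \<subseteq> C" "inj_on col I" "gf2.independent (col ` I)"
      and J: "J \<subseteq> C" "inj_on col J" "gf2.independent (col ` J)" and less: "card I < card J"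
    for I J
  proof -
    have "finite I" using I assms finite_subset by blast
    have "\<not> col ` J \<subseteq> gf2.span (col ` I)"
    proof
      assume "col ` J \<subseteq> gf2.span (col ` I)"
      then have "card (col ` J) \<le> card (col ` I)"
        using gf2.independent_span_bound[OF _ J(3)] \<open>finite I\<close> by blast
      then show False using less I(2) J(2) by (simp add: card_image)
    qed
    then obtain e where e: "e \<in> J" "col e \<notin> gf2.span (col ` I)" by blast
    then have "col e \<notin> col ` I" using gf2.span_base by blast
    then show ?thesis
      using e I J by (intro bexI[of _ e]) (auto simp: gf2.independent_insert)
  qed
  have subset: "gf2.independent (col ` J)" if "gf2.independent (col ` I)" "J \<subseteq> I" for I J
    using gf2.independent_mono[OF that(1) image_mono[OF that(2)]] .
  show ?thesis
    unfolding is_matroid_def eq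
    using assms augment subset by (auto simp: gf2.independent_empty intro: inj_on_subset)
qed

section \<open>The matroid of the matrix \<open>(I | A(G) | I + A(G))\<close>\<close>

datatype label = Phi | Chi | Psi

definition identity_matrix :: "'v \<Rightarrow> 'v \<Rightarrow> bit" where
  "identity_matrix u v = (if u = v then 1 else 0)"

definition adjacency_matrix :: "'v graph \<Rightarrow> 'v \<Rightarrow> 'v \<Rightarrow> bit" where
  "adjacency_matrix G u v = (if {u, v} \<in> edges G then 1 else 0)"

text \<open>
  The column label \<open>(v, \<iota>)\<close> stands for \<open>v\<^sub>\<iota>\<close>. The row index ranges over the whole type, but for a
  looped simple graph \<open>G\<close> and \<open>v \<in> verts G\<close> all entries outside the rows \<open>verts G\<close> are zero.
\<close>

fun IAS :: "'v graph \<Rightarrow> 'v \<Rightarrow> 'v \<times> label \<Rightarrow> bit" where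
  "IAS G u (v, Phi) = identity_matrix u v"
| "IAS G u (v, Chi) = adjacency_matrix G u v"
| "IAS G u (v, Psi) = identity_matrix u v + adjacency_matrix G u v"

lemma IAS_outside_verts:
  assumes "looped_simple_graph G" "v \<in> verts G" "u \<notin> verts G"
  shows "IAS G u (v, \<iota>) = 0"
  using assms
  by (cases \<iota>) (auto simp: identity_matrix_def adjacency_matrix_def looped_simple_graph_def
      doubleton_eq_iff)

definition cell :: "'v \<Rightarrow> ('v \<times> label) set" where
  "cell v = {(v, Phi), (v, Chi), (v, Psi)}"

definition M_IAS :: "'v graph \<Rightarrow> ('v \<times> label) matroid" where
  "M_IAS G = binary_matroid (IAS G) (\<Union>v\<in>verts G. cell v)"

lemma is_matroid_M_IAS: "looped_simple_graph G \<Longrightarrow> is_matroid (M_IAS G)"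
  unfolding M_IAS_def looped_simple_graph_def
  by (intro is_matroid_binary_matroid) (auto simp: cell_def)

definition compatible_isomorphism ::
    "'v graph \<Rightarrow> 'w graph \<Rightarrow> ('v \<times> label \<Rightarrow> 'w \<times> label) \<Rightarrow> bool" where
  "compatible_isomorphism G H \<beta> \<longleftrightarrow>
     matroid_isomorphism (M_IAS G) (M_IAS H) \<beta> \<and>
     (\<forall>v\<in>verts G. \<exists>w\<in>verts H. \<beta> ` cell v = cell w)"

definition induced_vertex_map :: "('v \<times> label \<Rightarrow> 'w \<times> label) \<Rightarrow> 'v \<Rightarrow> 'w" where
  "induced_vertex_map \<beta> v = (THE w. \<beta> ` cell v = cell w)"

definition induced_label_perm :: "('v \<times> label \<Rightarrow> 'w \<times> label) \<Rightarrow> 'v \<Rightarrow> label \<Rightarrow> label" where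
  "induced_label_perm \<beta> v = (\<lambda>\<iota>. THE \<kappa>. \<beta> (v, \<iota>) = (induced_vertex_map \<beta> v, \<kappa>))"

lemma mem_cell_iff: "e \<in> cell v \<longleftrightarrow> fst e = v"
  by (cases e; cases "snd e") (auto simp: cell_def)

lemma cell_eq_iff: "cell v = cell w \<longleftrightarrow> v = w"
  by (auto simp: cell_def)

lemma image_cell:
  assumes "compatible_isomorphism G H \<beta>" "v \<in> verts G"
  shows "induced_vertex_map \<beta> v \<in> verts H" "\<beta> ` cell v = cell (induced_vertex_map \<beta> v)"
proof -
  obtain w where w: "w \<in> verts H" "\<beta> ` cell v = cell w"
    using assms unfolding compatible_isomorphism_def by blast
  then have "induced_vertex_map \<beta> v = w"
    unfolding induced_vertex_map_def by (auto simp: cell_eq_iff)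
  with w show "induced_vertex_map \<beta> v \<in> verts H" "\<beta> ` cell v = cell (induced_vertex_map \<beta> v)"
    by auto
qed

lemma compatible_isomorphism_apply:
  assumes "compatible_isomorphism G H \<beta>" "v \<in> verts G"
  shows "\<beta> (v, \<iota>) = (induced_vertex_map \<beta> v, induced_label_perm \<beta> v \<iota>)"
proof -
  have "\<beta> (v, \<iota>) \<in> cell (induced_vertex_map \<beta> v)"
    using image_cell(2)[OF assms] by (auto simp: mem_cell_iff)
  then obtain \<kappa> where "\<beta> (v, \<iota>) = (induced_vertex_map \<beta> v, \<kappa>)"
    by (cases "\<beta> (v, \<iota>)") (auto simp: mem_cell_iff)
  then show ?thesis by (simp add: induced_label_perm_def)
qed

lemma induced_label_perm_permutes:
  assumes "compatible_isomorphism G H \<beta>" "v \<in> verts G"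
  shows "induced_label_perm \<beta> v permutes UNIV"
proof -
  have "\<kappa> \<in> range (induced_label_perm \<beta> v)" for \<kappa>
  proof -
    have "(induced_vertex_map \<beta> v, \<kappa>) \<in> \<beta> ` cell v"
      using image_cell(2)[OF assms] by (simp add: mem_cell_iff)
    then obtain \<iota> where "(induced_vertex_map \<beta> v, \<kappa>) = \<beta> (v, \<iota>)"
      by (auto simp: mem_cell_iff)
    then show ?thesis by (auto simp: compatible_isomorphism_apply[OF assms])
  qed
  then have "surj (induced_label_perm \<beta> v)" by blast
  moreover have "finite (UNIV :: label set)"
  proof -
    have "(UNIV :: label set) = {Phi, Chi, Psi}" using label.exhaust by blast
    then show ?thesis by (metis finite.emptyI finite.insertI)
  qed
  ultimately show ?thesis
    by (intro bij_imp_permutes) (auto simp: bij_def finite_UNIV_surj_inj)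
qed

lemma induced_vertex_map_bij_betw:
  assumes "compatible_isomorphism G H \<beta>"
  shows "bij_betw (induced_vertex_map \<beta>) (verts G) (verts H)"
proof (rule bij_betw_imageI)
  have bij: "bij_betw \<beta> (\<Union>v\<in>verts G. cell v) (\<Union>w\<in>verts H. cell w)"
    using assms
    by (simp add: compatible_isomorphism_def matroid_isomorphism_def M_IAS_def
        binary_matroid_def Let_def)
  show "inj_on (induced_vertex_map \<beta>) (verts G)"
  proof (rule inj_onI)
    fix u v
    assume uv: "u \<in> verts G" "v \<in> verts G"
      and eq: "induced_vertex_map \<beta> u = induced_vertex_map \<beta> v"
    then have "\<beta> (u, Phi) \<in> \<beta> ` cell v"
      using image_cell(2)[OF assms] by (metis fst_conv imageI mem_cell_iff)
    then obtain e where "e \<in> cell v" "\<beta> (u, Phi) = \<beta> e" by auto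
    with uv bij have "(u, Phi) = e"
      by (auto simp: mem_cell_iff bij_betw_def dest!: inj_onD)
    with \<open>e \<in> cell v\<close> show "u = v" by (auto simp: mem_cell_iff)
  qed
  have "w \<in> induced_vertex_map \<beta> ` verts G" if "w \<in> verts H" for w
  proof -
    have "(w, Phi) \<in> \<beta> ` (\<Union>v\<in>verts G. cell v)"
      using bij that by (auto simp: bij_betw_def mem_cell_iff)
    then obtain v where "v \<in> verts G" "(w, Phi) \<in> \<beta> ` cell v" by blast
    then have "w = induced_vertex_map \<beta> v"
      using image_cell(2)[OF assms] by (simp add: mem_cell_iff)
    with \<open>v \<in> verts G\<close> show ?thesis by blast
  qed
  then show "induced_vertex_map \<beta> ` verts G = verts H"
    using image_cell(1)[OF assms] by blast
qed

end

theory Submission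
  imports Defs
begin

text \<open>
  Complementing the loop at \<open>v\<close> exchanges the columns \<open>v\<^sub>\<chi>\<close> and \<open>v\<^sub>\<psi>\<close> and fixes the rest of the
  matrix, which gives (1) \<open>\<Longrightarrow>\<close> (2). Conversely, an isomorphism with \<open>f\<^sub>\<beta>(v) \<in> {1, (\<chi>\<psi>)}\<close> preserves
  the basis of all \<open>v\<^sub>\<phi>\<close>, and the fundamental circuits with respect to that basis determine every
  entry of the matrix: the entry of the column \<open>v\<^sub>\<iota>\<close>, \<open>\<iota> \<noteq> \<phi>\<close>, in row \<open>u\<close> is \<open>1\<close> iff exchanging
  \<open>u\<^sub>\<phi>\<close> for \<open>v\<^sub>\<iota>\<close> yields an independent set.
\<close>

lemma sum_fun_apply: "(\<Sum>c\<in>T. f c) r = (\<Sum>c\<in>T. f c r)"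
  by (induction T rule: infinite_finite_induct) auto

text \<open>Over GF(2) a linear combination is determined by its support, so linear independence of
  a family of columns concerns plain subset sums. The injectivity clause is absorbed: two labels
  with equal columns already form a zero sum. From here on only sums over label sets occur, no
  spans.\<close>

lemma indeps_binary_matroid_iff:
  assumes "finite S"
  shows "S \<in> indeps (binary_matroid A C) \<longleftrightarrow>
    S \<subseteq> C \<and> (\<forall>T\<subseteq>S. (\<forall>r. (\<Sum>c\<in>T. A r c) = 0) \<longrightarrow> T = {})"
proof -
  define col where "col = (\<lambda>c r. A r c)"
  have sum_col: "(\<Sum>c\<in>T. col c) = 0 \<longleftrightarrow> (\<forall>r. (\<Sum>c\<in>T. A r c) = 0)" for T
    by (auto simp: fun_eq_iff sum_fun_apply col_def)
  have "inj_on col S \<and> gf2.independent (col ` S) \<longleftrightarrow>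
    (\<forall>T\<subseteq>S. (\<Sum>c\<in>T. col c) = 0 \<longrightarrow> T = {})" (is "?L \<longleftrightarrow> ?R")
  proof
    assume L: ?L
    show ?R
    proof (intro allI impI)
      fix T assume T: "T \<subseteq> S" "(\<Sum>c\<in>T. col c) = 0"
      define a :: "_ \<Rightarrow> bit" where "a x = (if x \<in> col ` T then 1 else 0)" for x
      have "(\<Sum>x\<in>col ` S. gf2_scale (a x) x) = (\<Sum>x\<in>col ` T. x)"
        using T(1) assms
        by (intro sum.mono_neutral_cong_right) (auto simp: a_def gf2_scale_def fun_eq_iff)
      also have "\<dots> = (\<Sum>c\<in>T. col c)"
        using L T(1) by (subst sum.reindex) (auto intro: inj_on_subset)
      finally have "(\<Sum>x\<in>col ` S. gf2_scale (a x) x) = 0"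
        using T(2) by simp
      then have "a x = 0" if "x \<in> col ` S" for x
        using L that assms by (auto simp: gf2.dependent_finite)
      then show "T = {}"
        using T(1) by (fastforce simp: a_def split: if_splits)
    qed
  next
    assume R: ?R
    have inj: "inj_on col S"
    proof (rule inj_onI, rule ccontr)
      fix c d assume cd: "c \<in> S" "d \<in> S" "col c = col d" "c \<noteq> d"
      \<comment> \<open>Equal columns cancel in characteristic 2.\<close>
      then have "(\<Sum>e\<in>{c, d}. col e) = 0" by (simp add: fun_eq_iff)
      with R cd show False by (metis empty_subsetI insert_not_empty insert_subset)
    qed
    have "a x = 0" if sum0: "(\<Sum>x\<in>col ` S. gf2_scale (a x) x) = 0" and x: "x \<in> col ` S" for a x
    proof -
      \<comment> \<open>The support of \<open>a\<close>, pulled back along \<open>col\<close>; every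
        coefficient on it is 1.\<close>
      define T where "T = {c \<in> S. a (col c) \<noteq> 0}"
      have "(\<Sum>x\<in>col ` S. gf2_scale (a x) x) = (\<Sum>c\<in>S. gf2_scale (a (col c)) (col c))"
        using inj by (simp add: sum.reindex)
      also have "\<dots> = (\<Sum>c\<in>T. col c)"
        using assms
        by (intro sum.mono_neutral_cong_right) (auto simp: T_def gf2_scale_def fun_eq_iff)
      finally have "(\<Sum>c\<in>T. col c) = 0" using sum0 by simp
      moreover have "T \<subseteq> S" by (auto simp: T_def)
      ultimately have "T = {}" using R by blast
      with x show ?thesis by (auto simp: T_def)
    qed
    with inj assms show ?L by (auto simp: gf2.dependent_finite)
  qed
  then show ?thesis
    by (simp add: binary_matroid_def Let_def sum_col flip: col_def)
qed

lemma edges_complement_loops: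
  "{u, v} \<in> edges (complement_loops G S) \<longleftrightarrow> ({u, v} \<in> edges G) \<noteq> (u = v \<and> v \<in> S)"
  by (auto simp: complement_loops_def Let_def doubleton_eq_iff)

lemma verts_complement_loops [simp]: "verts (complement_loops G S) = verts G"
  by (simp add: complement_loops_def Let_def)

text \<open>Toggling a diagonal entry adds the unit vector of \<open>v\<close> to both
  \<open>A(G)\<close> and \<open>I + A(G)\<close> columns of \<open>v\<close>. In characteristic 2
  this turns each into the other.\<close>

lemma IAS_complement_loops:
  "IAS (complement_loops G S) u (v, \<iota>) = IAS G u (v, (if v \<in> S then transpose Chi Psi else id) \<iota>)"
  by (cases \<iota>) (auto simp: adjacency_matrix_def identity_matrix_def edges_complement_loops)

lemma IAS_graph_isomorphism:
  assumes "graph_isomorphism G H h" "u \<in> verts G" "v \<in> verts G"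
  shows "IAS H (h u) (h v, \<iota>) = IAS G u (v, \<iota>)"
proof -
  have "h u = h v \<longleftrightarrow> u = v"
    using assms by (auto simp: graph_isomorphism_def bij_betw_def dest: inj_onD)
  then show ?thesis
    using assms by (cases \<iota>) (auto simp: adjacency_matrix_def identity_matrix_def graph_isomorphism_def)
qed

lemma Union_cell: "(\<Union>v\<in>X. cell v) = X \<times> UNIV"
  by (auto simp: mem_cell_iff)

lemma finite_UNIV_label: "finite (UNIV :: label set)"
proof -
  have "(UNIV :: label set) = {Phi, Chi, Psi}" using label.exhaust by blast
  then show ?thesis by (metis finite.emptyI finite.insertI)
qed

text \<open>Rows outside \<open>verts G\<close> vanish on the ground set. Dropping them lets the
  criterion be transported along a bijection of vertex sets, which controls no other rows.\<close>

lemma indeps_M_IAS_iff: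
  assumes "looped_simple_graph G" "S \<subseteq> verts G \<times> UNIV"
  shows "S \<in> indeps (M_IAS G) \<longleftrightarrow>
    (\<forall>T\<subseteq>S. (\<forall>r\<in>verts G. (\<Sum>c\<in>T. IAS G r c) = 0) \<longrightarrow> T = {})"
proof -
  have "finite S"
    using assms finite_UNIV_label
    by (metis finite_SigmaI finite_subset looped_simple_graph_def)
  moreover have "(\<Sum>c\<in>T. IAS G r c) = 0" if "T \<subseteq> S" "r \<notin> verts G" for T r
    using that assms by (intro sum.neutral) (auto simp: IAS_outside_verts)
  then have "(\<forall>r. (\<Sum>c\<in>T. IAS G r c) = 0) \<longleftrightarrow> (\<forall>r\<in>verts G. (\<Sum>c\<in>T. IAS G r c) = 0)" if "T \<subseteq> S" for T
    using that by blast
  ultimately show ?thesis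
    using assms(2) by (auto simp: M_IAS_def Union_cell indeps_binary_matroid_iff)
qed

lemma matroid_isomorphism_M_IAS:
  assumes G: "looped_simple_graph G" and H: "looped_simple_graph H"
    and h: "bij_betw h (verts G) (verts H)"
    and \<beta>: "bij_betw \<beta> (verts G \<times> UNIV) (verts H \<times> UNIV)"
    and entry: "\<And>u c. u \<in> verts G \<Longrightarrow> c \<in> verts G \<times> UNIV \<Longrightarrow> IAS H (h u) (\<beta> c) = IAS G u c"
  shows "matroid_isomorphism (M_IAS G) (M_IAS H) \<beta>"
proof -
  have "S \<in> indeps (M_IAS G) \<longleftrightarrow> \<beta> ` S \<in> indeps (M_IAS H)" if S: "S \<subseteq> verts G \<times> UNIV" for S
  proof -
    have "(\<Sum>c\<in>\<beta> ` T. IAS H (h u) c) = (\<Sum>c\<in>T. IAS G u c)" if "T \<subseteq> S" "u \<in> verts G" for T u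
    proof -
      have "T \<subseteq> verts G \<times> UNIV" using that S by blast
      moreover from this \<beta> have "inj_on \<beta> T" by (auto simp: bij_betw_def intro: inj_on_subset)
      ultimately show ?thesis
        using entry that(2) by (auto simp: sum.reindex intro!: sum.cong)
    qed
    moreover have "verts H = h ` verts G" "\<beta> ` S \<subseteq> verts H \<times> UNIV"
      using h \<beta> S by (auto simp: bij_betw_def)
    ultimately show ?thesis
      using S by (simp add: indeps_M_IAS_iff[OF G] indeps_M_IAS_iff[OF H] all_subset_image)
  qed
  with \<beta> show ?thesis
    by (simp add: matroid_isomorphism_def M_IAS_def binary_matroid_def Let_def Union_cell)
qed

text \<open>The columns \<open>(w, Phi)\<close> with \<open>w \<noteq> u\<close> are unit vectors
  spanning the vectors with zero entry in row \<open>u\<close>, so a further column is independent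
  of them iff its entry there is nonzero. The label \<open>Phi\<close> must be excluded: for
  \<open>v \<noteq> u\<close> inserting \<open>(v, Phi)\<close> changes nothing, so the set is
  independent although the entry is 0.\<close>

lemma IAS_eq_1_iff_exchange:
  assumes G: "looped_simple_graph G" and u: "u \<in> verts G" and v: "v \<in> verts G"
    and \<iota>: "\<iota> \<noteq> Phi"
  shows "IAS G u (v, \<iota>) = 1 \<longleftrightarrow>
    insert (v, \<iota>) ((verts G - {u}) \<times> {Phi}) \<in> indeps (M_IAS G)"
proof -
  let ?B = "(verts G - {u}) \<times> {Phi}"
  have fin: "finite (verts G)" using G by (simp add: looped_simple_graph_def)
  have sum_Phi: "(\<Sum>c\<in>T. IAS G r c) = (if (r, Phi) \<in> T then 1 else 0)"
    if T: "T \<subseteq> verts G \<times> {Phi}" for T r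
  proof -
    have "finite T" using T by (rule finite_subset) (simp add: fin)
    moreover have "(\<Sum>c\<in>T. IAS G r c) = (\<Sum>c\<in>T. if c = (r, Phi) then 1 else 0)"
    proof (rule sum.cong)
      fix c assume "c \<in> T"
      then obtain w where "c = (w, Phi)" using T by blast
      then show "IAS G r c = (if c = (r, Phi) then 1 else 0)"
        by (auto simp: identity_matrix_def)
    qed simp
    ultimately show ?thesis by simp
  qed
  have S: "insert (v, \<iota>) ?B \<subseteq> verts G \<times> UNIV" using v by auto
  show ?thesis
    unfolding indeps_M_IAS_iff[OF G S]
  proof (intro iffI allI impI)
    fix T assume 1: "IAS G u (v, \<iota>) = 1" and T: "T \<subseteq> insert (v, \<iota>) ?B"
      and 0: "\<forall>r\<in>verts G. (\<Sum>c\<in>T. IAS G r c) = 0"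
    have "finite T" using T by (rule finite_subset) (simp add: fin)
    \<comment> \<open>In row \<open>u\<close> no column of \<open>?B\<close> contributes, so a zero
      sum cannot contain a column with entry 1 there.\<close>
    have "(v, \<iota>) \<notin> T"
    proof
      assume "(v, \<iota>) \<in> T"
      then have "(\<Sum>c\<in>T. IAS G u c) = IAS G u (v, \<iota>) + (\<Sum>c\<in>T - {(v, \<iota>)}. IAS G u c)"
        using \<open>finite T\<close> by (rule sum.remove[rotated])
      also have "(\<Sum>c\<in>T - {(v, \<iota>)}. IAS G u c) = 0"
        using T by (subst sum_Phi) auto
      finally show False using 0 u 1 by simp
    qed
    then have T: "T \<subseteq> ?B" using T by blast
    have "(r, Phi) \<notin> T" if "r \<in> verts G" for r
    proof -
      have "(\<Sum>c\<in>T. IAS G r c) = (if (r, Phi) \<in> T then 1 else 0)"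
        using T by (intro sum_Phi) auto
      then show ?thesis using 0 that by (auto split: if_splits)
    qed
    with T show "T = {}" by fastforce
  next
    assume indep: "\<forall>T\<subseteq>insert (v, \<iota>) ?B. (\<forall>r\<in>verts G. (\<Sum>c\<in>T. IAS G r c) = 0) \<longrightarrow> T = {}"
    show "IAS G u (v, \<iota>) = 1"
    proof (rule ccontr)
      assume "IAS G u (v, \<iota>) \<noteq> 1"
      then have u0: "IAS G u (v, \<iota>) = 0" by simp
      \<comment> \<open>The expansion of the column \<open>(v, \<iota>)\<close> in unit vectors. It
        avoids \<open>(u, Phi)\<close> because the entry in row \<open>u\<close> is 0, so
        \<open>insert (v, \<iota>) T\<close> is a dependency inside the exchanged set.\<close>
      define T where "T = {w \<in> verts G. IAS G w (v, \<iota>) = 1} \<times> {Phi}"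
      have "finite T" "(v, \<iota>) \<notin> T" "T \<subseteq> ?B" using fin \<iota> u0 by (auto simp: T_def)
      have "(\<Sum>c\<in>insert (v, \<iota>) T. IAS G r c) = 0" if "r \<in> verts G" for r
      proof -
        have "(\<Sum>c\<in>T. IAS G r c) = IAS G r (v, \<iota>)"
          using that by (subst sum_Phi) (auto simp: T_def)
        with \<open>finite T\<close> \<open>(v, \<iota>) \<notin> T\<close> show ?thesis by simp
      qed
      with indep \<open>T \<subseteq> ?B\<close> show False by (metis insert_mono insert_not_empty)
    qed
  qed
qed

text \<open>Since \<open>\<beta>\<close> respects the label \<open>Phi\<close>, it carries the
  exchanged set for an entry of \<open>G\<close> to the exchanged set for the corresponding entry of
  \<open>H\<close>, and it preserves independence.\<close>

lemma IAS_compatible_isomorphism: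
  assumes G: "looped_simple_graph G" and H: "looped_simple_graph H"
    and iso: "compatible_isomorphism G H \<beta>"
    and Phi: "\<And>v. v \<in> verts G \<Longrightarrow> induced_label_perm \<beta> v Phi = Phi"
    and uv: "u \<in> verts G" "v \<in> verts G" and \<iota>: "\<iota> \<noteq> Phi"
  shows "IAS H (induced_vertex_map \<beta> u) (\<beta> (v, \<iota>)) = IAS G u (v, \<iota>)"
proof -
  let ?h = "induced_vertex_map \<beta>" and ?f = "induced_label_perm \<beta>"
  note \<beta> = compatible_isomorphism_apply[OF iso]
  have h: "bij_betw ?h (verts G) (verts H)"
    using iso by (rule induced_vertex_map_bij_betw)
  have "inj (?f v)"
    using induced_label_perm_permutes[OF iso uv(2)] by (rule permutes_inj)
  \<comment> \<open>Needed to apply the exchange criterion in \<open>H\<close> as well.\<close>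
  then have f\<iota>: "?f v \<iota> \<noteq> Phi" using Phi[OF uv(2)] \<iota> by (metis injD)
  have "\<beta> ` ((verts G - {u}) \<times> {Phi}) = ?h ` (verts G - {u}) \<times> {Phi}"
    using Phi by (force simp: \<beta>)
  also have "?h ` (verts G - {u}) = verts H - {?h u}"
    using h uv(1) by (auto simp: bij_betw_def dest: inj_onD)
  finally have "\<beta> ` insert (v, \<iota>) ((verts G - {u}) \<times> {Phi}) =
      insert (?h v, ?f v \<iota>) ((verts H - {?h u}) \<times> {Phi})"
    by (simp add: \<beta>[OF uv(2)])
  moreover have "insert (v, \<iota>) ((verts G - {u}) \<times> {Phi}) \<subseteq> ground (M_IAS G)"
    using uv by (auto simp: M_IAS_def binary_matroid_def Let_def Union_cell)
  ultimately have "insert (v, \<iota>) ((verts G - {u}) \<times> {Phi}) \<in> indeps (M_IAS G) \<longleftrightarrow>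
      insert (?h v, ?f v \<iota>) ((verts H - {?h u}) \<times> {Phi}) \<in> indeps (M_IAS H)"
    using iso by (metis compatible_isomorphism_def matroid_isomorphism_def)
  then have "IAS G u (v, \<iota>) = 1 \<longleftrightarrow> IAS H (?h u) (\<beta> (v, \<iota>)) = 1"
    using uv h f\<iota> \<iota>
    by (simp add: IAS_eq_1_iff_exchange[OF G] IAS_eq_1_iff_exchange[OF H] \<beta> bij_betwE)
  then show ?thesis by (metis bit_not_one_iff)
qed

theorem theorem13:
  fixes G1 :: "'v graph" and G2 :: "'w graph"
  assumes "looped_simple_graph G1" and "looped_simple_graph G2"
  shows "(\<exists>S \<subseteq> verts G1. isomorphic_graphs (complement_loops G1 S) G2) \<longleftrightarrow>
         (\<exists>\<beta>. compatible_isomorphism G1 G2 \<beta> \<and>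
              (\<forall>v\<in>verts G1. induced_label_perm \<beta> v \<in> {id, transpose Chi Psi}))"
proof
  assume "\<exists>S \<subseteq> verts G1. isomorphic_graphs (complement_loops G1 S) G2"
  then obtain S h where h: "graph_isomorphism (complement_loops G1 S) G2 h"
    by (auto simp: isomorphic_graphs_def)
  define f :: "'v \<Rightarrow> label \<Rightarrow> label" where "f v = (if v \<in> S then transpose Chi Psi else id)" for v
  define \<beta> where "\<beta> = (\<lambda>(v, \<iota>). (h v, f v \<iota>))"
  \<comment> \<open>Being an involution makes \<open>f v\<close> bijective on each cell; it also
    lets the swap in \<open>\<beta>\<close> cancel the one from \<open>IAS_complement_loops\<close>
    when entries are compared.\<close>
  have ff: "f v (f v \<iota>) = \<iota>" for v \<iota> by (simp add: f_def)
  have bij_h: "bij_betw h (verts G1) (verts G2)"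
    using h by (simp add: graph_isomorphism_def)
  have cell: "\<beta> ` cell v = cell (h v)" for v
  proof -
    have "surj (f v)" using ff by (metis surjI)
    moreover have "\<beta> ` ({v} \<times> UNIV) = {h v} \<times> range (f v)"
      by (auto simp: \<beta>_def)
    ultimately show ?thesis
      by (simp add: Union_cell[of "{_}", simplified])
  qed
  have "inj_on \<beta> (verts G1 \<times> UNIV)"
    using bij_h ff by (auto simp: inj_on_def \<beta>_def bij_betw_def) metis
  moreover have "\<beta> ` (verts G1 \<times> UNIV) = verts G2 \<times> UNIV"
    unfolding Union_cell[symmetric] image_UN cell bij_betw_imp_surj_on[OF bij_h, symmetric]
    by simp
  ultimately have "bij_betw \<beta> (verts G1 \<times> UNIV) (verts G2 \<times> UNIV)"
    by (simp add: bij_betw_def)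
  moreover have "IAS G2 (h u) (\<beta> c) = IAS G1 u c"
    if "u \<in> verts G1" "c \<in> verts G1 \<times> UNIV" for u c
    using that ff by (auto simp: \<beta>_def IAS_graph_isomorphism[OF h] IAS_complement_loops simp flip: f_def)
  ultimately have "matroid_isomorphism (M_IAS G1) (M_IAS G2) \<beta>"
    by (rule matroid_isomorphism_M_IAS[OF assms bij_h])
  then have iso: "compatible_isomorphism G1 G2 \<beta>"
    using cell bij_h by (auto simp: compatible_isomorphism_def bij_betwE)
  have "induced_label_perm \<beta> v = f v" if "v \<in> verts G1" for v
    using compatible_isomorphism_apply[OF iso that] by (auto simp: \<beta>_def)
  with iso show "\<exists>\<beta>. compatible_isomorphism G1 G2 \<beta> \<and>
      (\<forall>v\<in>verts G1. induced_label_perm \<beta> v \<in> {id, transpose Chi Psi})"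
    by (intro exI[of _ \<beta>]) (simp add: f_def)
next
  assume "\<exists>\<beta>. compatible_isomorphism G1 G2 \<beta> \<and>
    (\<forall>v\<in>verts G1. induced_label_perm \<beta> v \<in> {id, transpose Chi Psi})"
  then obtain \<beta> where iso: "compatible_isomorphism G1 G2 \<beta>"
    and perm: "\<And>v. v \<in> verts G1 \<Longrightarrow> induced_label_perm \<beta> v \<in> {id, transpose Chi Psi}"
    by blast
  let ?h = "induced_vertex_map \<beta>"
  \<comment> \<open>The vertices whose labels \<open>Chi\<close> and \<open>Psi\<close> are
    exchanged are those whose loop status has to be complemented.\<close>
  define S where "S = {v \<in> verts G1. induced_label_perm \<beta> v \<noteq> id}"
  define f :: "'v \<Rightarrow> label \<Rightarrow> label" where "f v = (if v \<in> S then transpose Chi Psi else id)" for v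
  have f: "induced_label_perm \<beta> v = f v" if "v \<in> verts G1" for v
    using perm[OF that] that by (auto simp: f_def S_def)
  have "{u, v} \<in> edges (complement_loops G1 S) \<longleftrightarrow> {?h u, ?h v} \<in> edges G2"
    if uv: "u \<in> verts G1" "v \<in> verts G1" for u v
  proof -
    \<comment> \<open>The label \<open>f v Chi\<close> is chosen so that \<open>\<beta>\<close>
      sends this column to the \<open>Chi\<close> column of \<open>?h v\<close>, whose entries are
      the adjacencies of \<open>G2\<close>. The same column of \<open>G1\<close> is the
      \<open>Chi\<close> column of \<open>v\<close> after complementing loops.\<close>
    have "IAS G2 (?h u) (\<beta> (v, f v Chi)) = IAS G1 u (v, f v Chi)"
      using uv by (intro IAS_compatible_isomorphism[OF assms iso]) (auto simp: f f_def)
    moreover have "\<beta> (v, f v Chi) = (?h v, Chi)"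
      using compatible_isomorphism_apply[OF iso uv(2)] f[OF uv(2)] by (simp add: f_def)
    ultimately have "IAS G2 (?h u) (?h v, Chi) = IAS G1 u (v, f v Chi)" by (simp only:)
    also have "\<dots> = IAS (complement_loops G1 S) u (v, Chi)"
      by (simp only: IAS_complement_loops f_def)
    finally show ?thesis by (simp add: adjacency_matrix_def split: if_splits)
  qed
  then have "graph_isomorphism (complement_loops G1 S) G2 ?h"
    using induced_vertex_map_bij_betw[OF iso] by (simp add: graph_isomorphism_def)
  then show "\<exists>S \<subseteq> verts G1. isomorphic_graphs (complement_loops G1 S) G2"
    unfolding isomorphic_graphs_def by (intro exI[of _ S] conjI exI[of _ ?h]) (auto simp: S_def)
qed

end
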